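(* There is a polynomial $P$ of degree $4$ with real coefficients such that all its critical points in $\mathbb{C}$ are real and such that, if we denote by $\mathscr{M}^{\mathbb{R}}$ (resp. $\mathscr{M}^{\mathbb{C}}$) the space of all Borel probability measures on $\mathbb{R}$ (resp. $\mathbb{C}$) that are invariant by $P$, then $$0<\inf\left\{\int\ln|DP|\,d\mu : \mu\in\mathscr{M}^{\mathbb{C}}\right\}<\inf\left\{\int\ln|DP|\,d\mu : \mu\in\mathscr{M}^{\mathbb{R}}\right\}.$$
   Context: $DP$ denotes the derivative of $P$, and $\ln 0=-\infty$. A Borel probability measure $\mu$ is invariant by $P$ if $\mu(P^{-1}(E))=\mu(E)$ for every Borel set $E$, where $P$ is regarded as a map of $\mathbb{R}$ (resp. $\mathbb{C}$) to itself. *)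

theory Defs
  imports "HOL-Probability.Probability" "HOL-Computational_Algebra.Polynomial"
begin

text \<open>Natural logarithm on the nonnegative reals with \<open>ln 0 = -\<infinity>\<close> (the library has
  \<open>ln 0 = 0\<close>). It is only applied to absolute values.\<close>

definition eln :: "real \<Rightarrow> ereal" where
  "eln x = (if x = 0 then - \<infinity> else ereal (ln x))"

text \<open>Lebesgue integral of an extended real function, as the integral of the positive part minus
  the integral of the negative part; \<open>e2ennreal\<close> sends negative arguments to \<open>0\<close>. The Bochner
  integral is unsuitable since it is \<open>0\<close> on nonintegrable functions, whereas \<open>\<integral>ln |DP| d\<mu>\<close> can
  be \<open>-\<infinity>\<close>. The difference is meaningful unless both parts are infinite. This does not occur
  below: by Poincare recurrence, an invariant probability measure of a polynomial of degree at
  least 2 is supported on a bounded set, so the positive part of \<open>ln |DP|\<close> has finite integral.\<close>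

definition eintegral :: "'a measure \<Rightarrow> ('a \<Rightarrow> ereal) \<Rightarrow> ereal" where
  "eintegral M f =
     enn2ereal (\<integral>\<^sup>+ x. e2ennreal (f x) \<partial>M) - enn2ereal (\<integral>\<^sup>+ x. e2ennreal (- f x) \<partial>M)"

definition invariant_probs :: "('a::topological_space \<Rightarrow> 'a) \<Rightarrow> 'a measure set" where
  "invariant_probs f =
     {\<mu>. prob_space \<mu> \<and> sets \<mu> = sets borel \<and>
         (\<forall>E \<in> sets borel. measure \<mu> (f -` E) = measure \<mu> E)}"

definition lyapunov :: "'a::real_normed_field poly \<Rightarrow> 'a measure \<Rightarrow> ereal" where
  "lyapunov P \<mu> = eintegral \<mu> (\<lambda>x. eln (norm (poly (pderiv P) x)))"

abbreviation complexify :: "real poly \<Rightarrow> complex poly" where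
  "complexify P \<equiv> map_poly complex_of_real P"

end

theory Submission
  imports Defs
begin

text \<open>Take \<open>P = T Q + small\<close> with \<open>Q = (z\<^sup>2 - 1) (z\<^sup>2 + 1/4)\<close> and \<open>T\<close> large. Invariant measures live on the
  filled Julia set, where \<open>Q\<close> is small, hence near the zeros \<open>1, -1, \<i>/2, -\<i>/2\<close> of \<open>Q\<close>; there
  \<open>\<bar>P'\<bar>\<close> is about \<open>T \<bar>Q'\<bar>\<close>, which is large but smaller by a factor \<open>2\<close> at the two nonreal zeros.
  Real invariant measures only see the zeros \<open>1, -1\<close>, while a fixed point near \<open>\<i>/2\<close> carries a
  complex invariant measure with a smaller exponent.\<close>

subsection \<open>Integrals of extended real functions\<close>

text \<open>In a T1 space the singleton of \<open>a\<close> is closed, hence Borel, so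
  \<open>x = a\<close> almost everywhere and each integrand can be replaced by a constant.\<close>

lemma eintegral_return:
  fixes a :: "'a::t1_space"
  shows "eintegral (return borel a) f = f a"
proof -
  have ae: "AE x in return borel a. x = a"
    by (subst AE_return) (auto simp: pred_def)
  have const: "(\<integral>\<^sup>+ x. g x \<partial>return borel a) = g a" for g :: "'a \<Rightarrow> ennreal"
  proof -
    interpret prob_space "return borel a" by (rule prob_space_return) simp
    have "(\<integral>\<^sup>+ x. g x \<partial>return borel a) = (\<integral>\<^sup>+ x. g a \<partial>return borel a)"
      using ae by (intro nn_integral_cong_AE) (auto elim: eventually_mono)
    then show ?thesis by (simp add: emeasure_space_1)
  qed
  show ?thesis
    unfolding eintegral_def const
    by (cases "0 \<le> f a") (auto simp: e2ennreal_neg enn2ereal_e2ennreal zero_ennreal.rep_eq)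
qed

lemma eintegral_ge_const:
  assumes "prob_space M" and c: "0 \<le> c" and ae: "AE x in M. ereal c \<le> f x"
  shows "ereal c \<le> eintegral M f"
proof -
  interpret prob_space M by fact
  have "(\<integral>\<^sup>+ x. e2ennreal (- f x) \<partial>M) = (\<integral>\<^sup>+ x. 0 \<partial>M)"
  proof (rule nn_integral_cong_AE)
    show "AE x in M. e2ennreal (- f x) = 0"
      using ae
    proof eventually_elim
      case (elim x)
      then have "0 \<le> f x" using c by (metis ereal_less_eq(5) order_trans)
      then show ?case by (simp add: e2ennreal_neg)
    qed
  qed
  then have neg: "(\<integral>\<^sup>+ x. e2ennreal (- f x) \<partial>M) = 0" by simp
  have "(\<integral>\<^sup>+ x. e2ennreal (ereal c) \<partial>M) \<le> (\<integral>\<^sup>+ x. e2ennreal (f x) \<partial>M)"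
    using ae by (intro nn_integral_mono_AE) (erule eventually_mono, rule e2ennreal_mono)
  then have "e2ennreal (ereal c) \<le> (\<integral>\<^sup>+ x. e2ennreal (f x) \<partial>M)"
    by (simp add: emeasure_space_1)
  then have "enn2ereal (e2ennreal (ereal c)) \<le> enn2ereal (\<integral>\<^sup>+ x. e2ennreal (f x) \<partial>M)"
    by (simp add: less_eq_ennreal.rep_eq)
  then show ?thesis
    using c by (simp add: eintegral_def neg enn2ereal_e2ennreal zero_ennreal.rep_eq)
qed

lemma eln_ge_ln: "0 < c \<Longrightarrow> c \<le> x \<Longrightarrow> ereal (ln c) \<le> eln x"
  by (auto simp: eln_def)

subsection \<open>Invariant measures\<close>

lemma return_in_invariant_probs:
  assumes "f a = a" and "f \<in> borel_measurable borel"
  shows "return borel a \<in> invariant_probs f"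
proof -
  have "f -` E \<in> sets borel" if "E \<in> sets borel" for E
    using measurable_sets[OF assms(2) that] by simp
  then show ?thesis
    using assms(1) by (auto simp: invariant_probs_def measure_return prob_space_return indicator_def)
qed

text \<open>Outside the ball of radius \<open>R\<close> the map at least doubles norms, so by
  invariance the mass of \<open>B r\<close> does not drop when \<open>r\<close> doubles. These sets
  decrease to the empty set, hence \<open>B R\<close> is null, and so is its preimage by
  invariance.\<close>

lemma invariant_probs_AE_bounded:
  fixes f :: "'a::real_normed_vector \<Rightarrow> 'a"
  assumes \<mu>: "\<mu> \<in> invariant_probs f" and f: "f \<in> borel_measurable borel" and "0 < R"
    and escape: "\<And>x. R < norm x \<Longrightarrow> 2 * norm x \<le> norm (f x)"
  shows "AE x in \<mu>. norm x \<le> R \<and> norm (f x) \<le> R"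
proof -
  interpret prob_space \<mu> using \<mu> by (simp add: invariant_probs_def)
  have sets: "sets \<mu> = sets borel" using \<mu> by (simp add: invariant_probs_def)
  then have space: "space \<mu> = UNIV" using sets_eq_imp_space_eq by fastforce
  define B where "B r = {x::'a. r < norm x}" for r
  have B: "B r \<in> sets borel" for r
    unfolding B_def by measurable
  have fB: "f -` B r \<in> sets borel" for r
    using measurable_sets[OF f B] by simp
  have inv: "measure \<mu> (f -` B r) = measure \<mu> (B r)" for r
    using \<mu> B by (simp add: invariant_probs_def)
  have step: "measure \<mu> (B r) \<le> measure \<mu> (B (2 * r))" if "R \<le> r" for r
  proof -
    have "B r \<subseteq> f -` B (2 * r)"
    proof
      fix x assume "x \<in> B r"
      then show "x \<in> f -` B (2 * r)"
        using that escape[of x] by (simp add: B_def)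
    qed
    then have "measure \<mu> (B r) \<le> measure \<mu> (f -` B (2 * r))"
      using fB by (intro finite_measure_mono) (auto simp: sets)
    then show ?thesis by (simp add: inv)
  qed
  have iter: "measure \<mu> (B R) \<le> measure \<mu> (B (2 ^ n * R))" for n
  proof (induction n)
    case (Suc n)
    have "1 * R \<le> 2 ^ n * R" using \<open>0 < R\<close> by (intro mult_right_mono) auto
    with Suc step[of "2 ^ n * R"] show ?case by (simp add: mult.assoc)
  qed simp
  have "(\<lambda>n. measure \<mu> (B (2 ^ n * R))) \<longlonglongrightarrow> measure \<mu> (\<Inter>n. B (2 ^ n * R))"
  proof (rule finite_Lim_measure_decseq)
    show "decseq (\<lambda>n. B (2 ^ n * R))"
      using \<open>0 < R\<close> unfolding B_def decseq_def
      by (auto intro: le_less_trans[OF mult_right_mono[OF power_increasing]])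
  qed (use B sets in auto)
  moreover have "(\<Inter>n. B (2 ^ n * R)) = {}"
  proof -
    have "x \<notin> (\<Inter>n. B (2 ^ n * R))" for x
    proof -
      obtain n where "norm x / R < 2 ^ n" using real_arch_pow[of 2] by auto
      then have "norm x < 2 ^ n * R" using \<open>0 < R\<close> by (simp add: field_simps)
      then show ?thesis by (auto simp: B_def intro!: exI[of _ n])
    qed
    then show ?thesis by blast
  qed
  ultimately have "(\<lambda>n. measure \<mu> (B (2 ^ n * R))) \<longlonglongrightarrow> 0" by simp
  then have "measure \<mu> (B R) \<le> 0"
    using iter by (intro LIMSEQ_le_const) auto
  then have null: "measure \<mu> (B R) = 0" by (simp add: measure_le_0_iff)
  then have "measure \<mu> (f -` B R) = 0" by (simp add: inv)
  with null have "B R \<in> null_sets \<mu>" "f -` B R \<in> null_sets \<mu>"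
    using B fB by (auto simp: null_sets_def sets emeasure_eq_measure)
  then have "AE x in \<mu>. x \<notin> B R" "AE x in \<mu>. x \<notin> f -` B R"
    by (auto dest: AE_not_in)
  then show ?thesis
    by eventually_elim (auto simp: B_def)
qed

text \<open>Turns a pointwise bound on the points that stay in the ball for one step into a bound on
  every exponent. As \<open>1 \<le> c\<close>, the logarithm is nonnegative almost everywhere and
  the negative part vanishes.\<close>

lemma lyapunov_ge:
  fixes P :: "'a::real_normed_field poly"
  assumes \<mu>: "\<mu> \<in> invariant_probs (poly P)" and "0 < R" "1 \<le> c"
    and escape: "\<And>x. R < norm x \<Longrightarrow> 2 * norm x \<le> norm (poly P x)"
    and lower: "\<And>x. norm x \<le> R \<Longrightarrow> norm (poly P x) \<le> R \<Longrightarrow> c \<le> norm (poly (pderiv P) x)"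
  shows "ereal (ln c) \<le> lyapunov P \<mu>"
  unfolding lyapunov_def
proof (rule eintegral_ge_const)
  have "poly P \<in> borel_measurable borel"
    by (intro borel_measurable_continuous_onI continuous_intros)
  then have "AE x in \<mu>. norm x \<le> R \<and> norm (poly P x) \<le> R"
    using invariant_probs_AE_bounded[OF \<mu>] \<open>0 < R\<close> escape by blast
  then show "AE x in \<mu>. ereal (ln c) \<le> eln (norm (poly (pderiv P) x))"
    by eventually_elim (use lower \<open>1 \<le> c\<close> in \<open>auto intro!: eln_ge_ln\<close>)
qed (use \<mu> \<open>1 \<le> c\<close> in \<open>auto simp: invariant_probs_def\<close>)

subsection \<open>The quartic\<close>

text \<open>The coefficients come from \<open>P = z + 80 ((z + \<eta>)\<^sup>2 + 1/4) ((z - \<eta>)\<^sup>2 - 1)\<close> with \<open>\<eta> = 1/200\<close>: the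
  factor \<open>80\<close> makes the linear term vanish, so that the fixed points \<open>\<eta> \<plusminus> 1\<close> and \<open>-\<eta> \<plusminus> \<i>/2\<close> as well as
  the critical points are explicit.\<close>

definition quartic :: "'a::real_normed_field poly" where
  "quartic = smult 80
     [:of_real (- (400029999 / 1600000000)), 0, of_real (- (15001 / 20000)), 0, 1:]"

lemma complexify_quartic: "complexify quartic = quartic"
  by (simp add: quartic_def map_poly_pCons)

lemma poly_quartic:
  "poly quartic (z :: 'a::real_normed_field) =
     80 * (z\<^sup>2 * (z\<^sup>2 - of_real (15001 / 20000)) - of_real (400029999 / 1600000000))"
  by (simp add: quartic_def algebra_simps power2_eq_square)

lemma poly_pderiv_quartic:
  "poly (pderiv quartic) (z :: 'a::real_normed_field) =
     160 * (z * (2 * z\<^sup>2 - of_real (15001 / 20000)))"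
  by (simp add: quartic_def pderiv_pCons pderiv_smult algebra_simps power2_eq_square)

lemma quartic_escape:
  fixes z :: "'a::real_normed_field"
  assumes "2 < norm z"
  shows "2 * norm z \<le> norm (poly quartic z)"
proof -
  define r where "r = norm z"
  define w where "w = z\<^sup>2"
  have r: "2 < r" using assms by (simp add: r_def)
  have nw: "norm w = r\<^sup>2" by (simp add: w_def r_def norm_power)
  have r2: "2 * r \<le> r\<^sup>2" using r by (simp add: power2_eq_square)
  have "norm w - 1 \<le> norm (w - of_real (15001 / 20000))"
    using norm_triangle_ineq2[of w "of_real (15001 / 20000)"] unfolding norm_of_real by simp
  then have "r\<^sup>2 - 1 \<le> norm (w - of_real (15001 / 20000))" by (simp only: nw)
  then have "r\<^sup>2 * 2 \<le> r\<^sup>2 * norm (w - of_real (15001 / 20000))"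
    using r r2 by (intro mult_left_mono) auto
  then have "r\<^sup>2 * 2 \<le> norm (w * (w - of_real (15001 / 20000)))"
    by (simp only: norm_mult nw)
  moreover have "norm (w * (w - of_real (15001 / 20000))) - 1
      \<le> norm (w * (w - of_real (15001 / 20000)) - of_real (400029999 / 1600000000))"
    using norm_triangle_ineq2[of "w * (w - of_real (15001 / 20000))"
        "of_real (400029999 / 1600000000)"] unfolding norm_of_real by simp
  moreover have "norm (poly quartic z) =
      80 * norm (w * (w - of_real (15001 / 20000)) - of_real (400029999 / 1600000000))"
    unfolding poly_quartic w_def by (simp only: norm_mult norm_numeral)
  ultimately show ?thesis using r r2 unfolding r_def by linarith
qed

text \<open>With \<open>w = z\<^sup>2\<close> the quartic is a multiple of \<open>w\<^sup>2 - a w - b\<close>, and \<open>(2 w - a)\<^sup>2\<close> differs from its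
  discriminant by \<open>4 (w\<^sup>2 - a w - b)\<close>.\<close>

lemma norm_pderiv_quartic_ge:
  fixes z :: "'a::real_normed_field"
  assumes z: "norm z \<le> 2" and Pz: "norm (poly quartic z) \<le> 2"
  shows "2 \<le> norm (poly (pderiv quartic) z)"
proof -
  define w where "w = z\<^sup>2"
  define a :: real where "a = 15001 / 20000"
  define b :: real where "b = 400029999 / 1600000000"
  define q where "q = w * (w - of_real a) - of_real b"
  have nw: "norm w = (norm z)\<^sup>2" by (simp add: w_def norm_power)
  have "norm w \<le> 4" using power_mono[OF z, of 2] by (simp add: nw)
  have "poly quartic z = 80 * q"
    unfolding poly_quartic q_def w_def a_def b_def ..
  then have q: "norm q \<le> 1 / 40"
    using Pz by (simp add: norm_mult)
  \<comment> \<open>Keeps \<open>z\<close> away from the critical point 0: \<open>b\<close> is about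
    1/4 and \<open>q\<close> is at most 1/40 in norm, so \<open>w * (w - a)\<close> cannot be
    small.\<close>
  have "norm (of_real b :: 'a) \<le> norm (w * (w - of_real a)) + norm q"
    using norm_triangle_ineq4[of "w * (w - of_real a)" q] by (simp add: q_def)
  then have "1 / 5 \<le> norm w * norm (w - of_real a)"
    using q by (simp add: norm_mult b_def)
  also have "norm (w - of_real a) \<le> 5"
    using norm_triangle_ineq4[of w "of_real a"] \<open>norm w \<le> 4\<close> by (simp add: a_def)
  then have "norm w * norm (w - of_real a) \<le> norm w * 5"
    by (intro mult_left_mono) auto
  finally have "(1 / 5)\<^sup>2 \<le> (norm z)\<^sup>2" by (simp add: nw power2_eq_square)
  then have nz: "1 / 5 \<le> norm z" by (rule power2_le_imp_le) simp
  have eq: "of_real (a\<^sup>2 + 4 * b) = (2 * w - of_real a)\<^sup>2 - 4 * q"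
    by (simp add: q_def power2_eq_square algebra_simps)
  have "norm (of_real (a\<^sup>2 + 4 * b) :: 'a) \<le> norm ((2 * w - of_real a)\<^sup>2) + norm (4 * q)"
    unfolding eq by (rule norm_triangle_ineq4)
  \<comment> \<open>The discriminant is about 1.56 and \<open>4 * q\<close> has norm at most
    1/10.\<close>
  then have "1\<^sup>2 \<le> (norm (2 * w - of_real a))\<^sup>2"
    unfolding norm_of_real using q by (simp add: norm_power norm_mult a_def b_def power2_eq_square)
  then have "1 \<le> norm (2 * w - of_real a)" by (rule power2_le_imp_le) simp
  with nz have "(1 / 5) * 1 \<le> norm z * norm (2 * w - of_real a)"
    by (intro mult_mono) auto
  then show ?thesis
    unfolding poly_pderiv_quartic w_def a_def norm_mult norm_numeral by linarith
qed

text \<open>A real square cannot be near the negative root, about -1/4, of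
  \<open>w\<^sup>2 - a w - b\<close>, so \<open>x\<^sup>2\<close> must be near the other root, about
  1. If it were below 9/10, the quartic would be less than -2.\<close>

lemma abs_pderiv_quartic_ge:
  fixes x :: real
  assumes "\<bar>x\<bar> \<le> 2" and Px: "\<bar>poly quartic x\<bar> \<le> 2"
  shows "120 \<le> \<bar>poly (pderiv quartic) x\<bar>"
proof -
  have w: "9 / 10 \<le> x\<^sup>2"
  proof (rule ccontr)
    assume "\<not> ?thesis"
    then have "x\<^sup>2 * (x\<^sup>2 - 15001 / 20000) \<le> x\<^sup>2 * (3 / 20)"
      by (intro mult_left_mono) auto
    with \<open>\<not> ?thesis\<close> Px show False
      unfolding poly_quartic by simp
  qed
  then have "(9 / 10)\<^sup>2 \<le> \<bar>x\<bar>\<^sup>2" by (simp add: power2_eq_square)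
  then have x: "9 / 10 \<le> \<bar>x\<bar>" by (rule power2_le_imp_le) simp
  have "9 / 10 * 1 \<le> \<bar>x\<bar> * \<bar>2 * x\<^sup>2 - 15001 / 20000\<bar>"
    using x w by (intro mult_mono) auto
  then show ?thesis
    unfolding poly_pderiv_quartic abs_mult by simp
qed

lemma quartic_fixed_real: "poly quartic (201 / 200 :: real) = 201 / 200"
  by (simp add: poly_quartic power2_eq_square)

lemma quartic_fixed_complex: "poly quartic (Complex (- 1 / 200) (1 / 2)) = Complex (- 1 / 200) (1 / 2)"
  by (simp add: poly_quartic power2_eq_square complex_eq_iff)

lemma norm_pderiv_quartic_fixed_complex:
  "norm (poly (pderiv quartic) (Complex (- 1 / 200) (1 / 2))) \<le> 110"
proof -
  define z where "z = Complex (- 1 / 200) (1 / 2)"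
  \<comment> \<open>In both factors one coordinate is tiny, so the sum of the absolute values of the
    coordinates is nearly the modulus; the product stays below 103 / 160.\<close>
  have "norm z \<le> 51 / 100"
    using cmod_le[of z] by (simp add: z_def)
  moreover have "norm (2 * z\<^sup>2 - of_real (15001 / 20000)) \<le> 126 / 100"
    using cmod_le[of "2 * z\<^sup>2 - of_real (15001 / 20000)"] by (simp add: z_def power2_eq_square)
  ultimately have "norm z * norm (2 * z\<^sup>2 - of_real (15001 / 20000)) \<le> 51 / 100 * (126 / 100)"
    by (intro mult_mono) auto
  then show ?thesis
    unfolding z_def[symmetric] poly_pderiv_quartic norm_mult norm_numeral by linarith
qed

lemma quartic_critical_point_real:
  assumes "poly (pderiv quartic) (z :: complex) = 0"
  shows "z \<in> \<real>"
proof -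
  define s where "s = sqrt (15001 / 40000)"
  have "s\<^sup>2 = 15001 / 40000" by (simp add: s_def)
  then have s: "(of_real s :: complex)\<^sup>2 = of_real (15001 / 40000)"
    by (metis of_real_power)
  have "z = 0 \<or> z\<^sup>2 = of_real (15001 / 40000)"
    using assms by (auto simp: poly_pderiv_quartic field_simps)
  then have "z = 0 \<or> z = of_real s \<or> z = - of_real s"
    using s by (metis power2_eq_iff)
  then show ?thesis by auto
qed

theorem propositionC:
  shows "\<exists>P :: real poly.
    degree P = 4 \<and>
    (\<forall>z :: complex. poly (pderiv (complexify P)) z = 0 \<longrightarrow> z \<in> \<real>) \<and>
    invariant_probs (poly P) \<noteq> {} \<and>
    0 < (INF \<mu> \<in> invariant_probs (poly (complexify P)). lyapunov (complexify P) \<mu>) \<and>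
    (INF \<mu> \<in> invariant_probs (poly (complexify P)). lyapunov (complexify P) \<mu>)
      < (INF \<mu> \<in> invariant_probs (poly P). lyapunov P \<mu>)"
proof (intro exI[of _ quartic] conjI allI impI; (unfold complexify_quartic)?)
  let ?z = "Complex (- 1 / 200) (1 / 2)"
  let ?C = "INF \<mu> \<in> invariant_probs (poly (quartic :: complex poly)). lyapunov quartic \<mu>"
  let ?R = "INF \<mu> \<in> invariant_probs (poly (quartic :: real poly)). lyapunov quartic \<mu>"
  show "degree (quartic :: real poly) = 4"
    by (simp add: quartic_def)
  show "z \<in> \<real>" if "poly (pderiv quartic) z = 0" for z :: complex
    using that by (rule quartic_critical_point_real)
  have meas: "poly P \<in> borel_measurable borel" for P :: "'a::real_normed_field poly"
    by (intro borel_measurable_continuous_onI continuous_intros)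
  \<comment> \<open>Over an empty set the real infimum would be \<infinity>.\<close>
  show "invariant_probs (poly (quartic :: real poly)) \<noteq> {}"
    using return_in_invariant_probs[of "poly quartic", OF quartic_fixed_real meas] by blast
  have C: "ereal (ln 2) \<le> ?C"
    by (intro INF_greatest lyapunov_ge[where R = 2] quartic_escape norm_pderiv_quartic_ge) auto
  then show "0 < ?C"
    by (rule less_le_trans[rotated]) simp
  have R: "ereal (ln 120) \<le> ?R"
    using quartic_escape[where ?'a = real] abs_pderiv_quartic_ge
    by (intro INF_greatest lyapunov_ge[where R = 2]) auto
  \<comment> \<open>The Dirac mass at the nonreal fixed point bounds the complex infimum from
    above.\<close>
  have inv: "return borel ?z \<in> invariant_probs (poly quartic)"
    by (rule return_in_invariant_probs[OF quartic_fixed_complex meas])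
  have "lyapunov quartic (return borel ?z) \<le> ereal (ln 110)"
    using norm_pderiv_quartic_fixed_complex
    unfolding lyapunov_def eintegral_return eln_def by simp
  with inv have "?C \<le> ereal (ln 110)"
    by (rule INF_lower2)
  also have "\<dots> < ereal (ln 120)" by simp
  also note R
  finally show "?C < ?R" .
qed

end
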